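(* Let $\pi$ be a permutation having label $(k,m_\ell)$, different from an identity permutation. Then the number of nodes of the tree $T(\pi)$ is $$N(k,m_\ell)=\sum_{j=0}^{m_\ell}j!\,(j+1)^{k-j}.$$ Moreover, each summand records the contribution of each level of $T(\pi)$: denoting by $N_j(k,m_\ell)$ the number of nodes at height $j$ in $T(\pi)$, for $0\le j\le m_\ell$, we have $N_j(k,m_\ell)=j!\,(j+1)^{k-j}$.
   Context: $S_n$ is the set of permutations $\pi=\pi_1\dots\pi_n$ of $\{1,\dots,n\}$ and $id_n=12\dots n$. An element $\pi_j$ is a left-to-right maximum of $\pi$ if $\pi_j>\pi_i$ for all $i<j$. The bubblesort operator $\mathbf{B}$ is one pass of the bubblesort algorithm: scan the positions from left to right, each time exchanging the current element with the one to its right whenever the latter is smaller. Equivalently, writing $\pi=\mu_1A_1\mu_2A_2\dots\mu_kA_k$ where the $\mu_i$ are all the left-to-right maxima of $\pi$ (and the $A_i$ are possibly empty sequences), $\mathbf{B}(\pi)=A_1\mu_1A_2\mu_2\dots A_k\mu_k$. $T_n$ is the rooted tree whose nodes are the permutations in $S_n$, with root $id_n$, in which $\tau$ is a child of $\sigma$ if and only if $\mathbf{B}(\tau)=\sigma$ and $\sigma\ne\tau$. For $\pi\in S_n$, $T(\pi)$ is the subtree of $T_n$ rooted at $\pi$ (consisting of $\pi$ and all its descendants). The height of a node in a rooted tree is the number of edges on the path connecting it to the root of that tree. The label of a permutation $\pi$ is the pair $(k,m_\ell)$ where $k$ is the number of left-to-right maxima of $\pi$ and $m_\ell\ge 0$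 is the length of the longest suffix of $\pi$ all of whose elements are left-to-right maxima of $\pi$ (the symbol $m_\ell$ is just a name for this integer). *)

theory Defs
  imports "HOL-Combinatorics.Multiset_Permutations" "HOL-Library.Sublist"
begin

text \<open>Permutations of \<open>{1..n}\<close> are represented by their one-line notation, a list of naturals;
  list positions are counted from 0.\<close>

definition Sym :: "nat \<Rightarrow> nat list set" where
  "Sym n = permutations_of_set {1..n}"

definition id_perm :: "nat \<Rightarrow> nat list" where
  "id_perm n = [1..<Suc n]"

definition ltr_maxima :: "nat list \<Rightarrow> nat set" where
  "ltr_maxima \<pi> = {\<pi> ! j | j. j < length \<pi> \<and> (\<forall>i<j. \<pi> ! i < \<pi> ! j)}"

fun bubble :: "nat list \<Rightarrow> nat list" where
  "bubble [] = []"
| "bubble [x] = [x]"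
| "bubble (x # y # zs) = (if y < x then y # bubble (x # zs) else x # bubble (y # zs))"

text \<open>The empty suffix is allowed, so the second component is the maximum of a nonempty set.\<close>

definition label :: "nat list \<Rightarrow> nat \<times> nat" where
  "label \<pi> = (card (ltr_maxima \<pi>), Max {length s | s. suffix s \<pi> \<and> set s \<subseteq> ltr_maxima \<pi>})"

text \<open>The tree \<open>T\<^sub>n\<close>, given by its (parent, child) pairs. The condition \<open>\<sigma> \<noteq> \<tau>\<close> only removes the
  loop at the root \<open>id_perm n\<close>.\<close>

definition bubble_tree :: "nat \<Rightarrow> (nat list \<times> nat list) set" where
  "bubble_tree n = {(\<sigma>, \<tau>). \<sigma> \<in> Sym n \<and> \<tau> \<in> Sym n \<and> bubble \<tau> = \<sigma> \<and> \<sigma> \<noteq> \<tau>}"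

text \<open>For a rooted tree with (parent, child) relation \<open>E\<close>: the nodes of the subtree rooted at \<open>r\<close>,
  and the height in that subtree of one of its nodes \<open>v\<close>. The path from \<open>r\<close> to \<open>v\<close> only runs
  through descendants of \<open>r\<close>, so \<open>E\<close> need not be restricted to the subtree; the
  path is unique in a tree, hence so is its length.\<close>

definition subtree_nodes :: "('a \<times> 'a) set \<Rightarrow> 'a \<Rightarrow> 'a set" where
  "subtree_nodes E r = {v. (r, v) \<in> E\<^sup>*}"

definition height :: "('a \<times> 'a) set \<Rightarrow> 'a \<Rightarrow> 'a \<Rightarrow> nat" where
  "height E r v = (THE j. (r, v) \<in> E ^^ j)"

end

theory Submission
  imports Defs
begin

text \<open>Encode a list by its inversion code: the entry at a position counts the larger elements to
  the left of that position. Its zeros are the positions of the left-to-right maxima, and on codes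
  \<^const>\<open>bubble\<close> deletes the first entry, decreases the others by one (stopping at zero) and
  appends a zero. So the \<open>j\<close>-fold preimages of \<open>\<pi>\<close> are given by codes whose first \<open>j\<close> entries are
  free, which yields \<open>j!\<close>, and whose later entries are determined wherever the code of \<open>\<pi>\<close> is
  nonzero and range over \<open>{0..j}\<close> at each of the \<open>k - j\<close> zeros of \<open>\<pi>\<close> before the last \<open>j\<close> ones;
  they exist iff \<open>\<pi>\<close> has at least \<open>j\<close> trailing zeros.\<close>

section \<open>Inversion codes of lists\<close>

text \<open>The set \<open>A\<close> collects the elements to the left of the list; codes of permutations have
  \<open>A = {}\<close>.\<close>

fun inv_code :: "'a::linorder set \<Rightarrow> 'a list \<Rightarrow> nat list" where
  "inv_code A [] = []"
| "inv_code A (x # xs) = card {y \<in> A. x < y} # inv_code (insert x A) xs"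

lemma length_inv_code [simp]: "length (inv_code A xs) = length xs"
  by (induction xs arbitrary: A) auto

lemma inv_code_snoc:
  "inv_code A (xs @ [x]) = inv_code A xs @ [card {y \<in> A \<union> set xs. x < y}]"
  by (induction xs arbitrary: A) auto

lemma nth_inv_code:
  "i < length xs \<Longrightarrow> inv_code A xs ! i = card {y \<in> A \<union> set (take i xs). xs ! i < y}"
proof (induction xs arbitrary: A i)
  case (Cons x xs)
  then show ?case by (cases i) auto
qed simp

lemma nth_inv_code_eq_0_iff:
  assumes "i < length xs"
  shows "inv_code {} xs ! i = 0 \<longleftrightarrow> (\<forall>j<i. xs ! j \<le> xs ! i)"
proof -
  have "set (take i xs) = (!) xs ` {..<i}"
    using assms by (simp add: nth_image lessThan_atLeast0)
  then show ?thesis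
    using assms by (auto simp: nth_inv_code not_less)
qed

text \<open>The last code entry is the number of elements of the common set exceeding the last
  element, so it fixes the rank of that element. Stripping it off leaves equal sets and equal codes,
  hence the induction from the right.\<close>

lemma inv_code_inj:
  assumes "distinct xs" "distinct ys" "set xs = set ys" "inv_code {} xs = inv_code {} ys"
  shows "xs = ys"
  using assms
proof (induction xs arbitrary: ys rule: rev_induct)
  case (snoc x xs)
  obtain y ys' where ys: "ys = ys' @ [y]"
    using snoc.prems(3) by (cases ys rule: rev_cases) auto
  let ?S = "set (xs @ [x])"
  have sets: "set (ys' @ [y]) = ?S" using snoc.prems ys by simp
  have "{z \<in> ?S. x < z} = {z \<in> set xs. x < z}" by auto
  moreover have "{z \<in> ?S. y < z} = {z \<in> set ys'. y < z}" using sets by auto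
  ultimately have card_eq: "card {z \<in> ?S. x < z} = card {z \<in> ?S. y < z}"
    using snoc.prems(4) by (simp add: ys inv_code_snoc)
  have less: "card {z \<in> ?S. b < z} < card {z \<in> ?S. a < z}" if "a < b" "b \<in> ?S" for a b
  proof (rule psubset_card_mono)
    show "finite {z \<in> ?S. a < z}" by simp
    show "{z \<in> ?S. b < z} \<subset> {z \<in> ?S. a < z}" using that by force
  qed
  have "y \<in> ?S" "x \<in> ?S" using sets by auto
  then have "x = y" using less[of x y] less[of y x] card_eq by (cases x y rule: linorder_cases) auto
  moreover have "set xs = set ys'"
    using snoc.prems(1,2) sets \<open>x = y\<close> by (auto simp: ys)
  ultimately show ?case
    using snoc.IH[of ys'] snoc.prems by (simp add: ys inv_code_snoc)
qed simp

section \<open>The effect of bubblesort passes on codes\<close>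

lemma mset_bubble [simp]: "mset (bubble xs) = mset xs"
  by (induction xs rule: bubble.induct) auto

lemma mset_funpow_bubble: "mset ((bubble ^^ j) xs) = mset xs"
  by (induction j) auto

lemma distinct_bubble: "distinct (bubble xs) \<longleftrightarrow> distinct xs"
  by (rule mset_eq_imp_distinct_iff) simp

text \<open>Invariant of the scan: \<open>x\<close> is the element being carried and
  \<open>A\<close> holds the elements already output, all below \<open>x\<close>. An overtaking
  \<open>y < x\<close> loses exactly \<open>x\<close> from its larger left neighbours. If
  \<open>y > x\<close>, then \<open>x\<close> is put down with code zero in place of the zero of
  \<open>y\<close>, and \<open>y\<close> is carried on. The last carried element is the maximum,
  giving the final zero.\<close>

lemma inv_code_bubble_from:
  assumes "finite A" "\<forall>a\<in>A. a < x" "distinct (x # zs)"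
  shows "inv_code A (bubble (x # zs)) = map (\<lambda>c. c - 1) (inv_code (insert x A) zs) @ [0]"
  using assms
proof (induction zs arbitrary: A x)
  case Nil
  then have "{y \<in> A. x < y} = {}" by auto
  then have "card {y \<in> A. x < y} = 0" by (simp only: card.empty)
  then show ?case by simp
next
  case (Cons y zs)
  show ?case
  proof (cases "y < x")
    case True
    have "{a \<in> insert x A. y < a} = insert x {a \<in> A. y < a}" using True by auto
    moreover have "x \<notin> A" using Cons.prems by auto
    ultimately have "card {a \<in> insert x A. y < a} - 1 = card {a \<in> A. y < a}"
      using Cons.prems by simp
    then show ?thesis
      using True Cons.prems Cons.IH[of "insert y A" x] by (simp add: insert_commute)
  next
    case False
    then have "x < y" using Cons.prems by auto
    then have less: "\<forall>a\<in>insert x A. a < y" using Cons.prems by auto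
    then have "{a \<in> insert x A. y < a} = {}" "{a \<in> A. x < a} = {}"
      using Cons.prems by fastforce+
    then have empty: "card {a \<in> insert x A. y < a} = 0" "card {a \<in> A. x < a} = 0"
      by (simp_all only: card.empty)
    have "inv_code (insert x A) (bubble (y # zs)) =
        map (\<lambda>c. c - 1) (inv_code (insert y (insert x A)) zs) @ [0]"
      using Cons.IH[OF _ less] Cons.prems by simp
    then show ?thesis
      using False by (simp add: empty del: insert_iff)
  qed
qed

lemma inv_code_bubble:
  assumes "distinct xs" "xs \<noteq> []"
  shows "inv_code {} (bubble xs) = map (\<lambda>c. c - 1) (tl (inv_code {} xs)) @ [0]"
  using assms inv_code_bubble_from[of "{}"] by (cases xs) auto

text \<open>Truncated subtractions of one compose to a truncated subtraction of \<open>j\<close>.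
  The \<open>min\<close> covers more passes than entries: from then on the code is all zeros, and a
  pass only replaces one zero by another.\<close>

lemma inv_code_funpow_bubble:
  assumes "distinct xs"
  shows "inv_code {} ((bubble ^^ j) xs) =
    map (\<lambda>c. c - j) (drop j (inv_code {} xs)) @ replicate (min j (length xs)) 0"
proof (cases "xs = []")
  case True
  then have "(bubble ^^ j) xs = []" by (metis mset_funpow_bubble mset_zero_iff)
  then show ?thesis using True by simp
next
  case False
  show ?thesis
  proof (induction j)
    case 0
    then show ?case by simp
  next
    case (Suc j)
    let ?ys = "(bubble ^^ j) xs"
    have "distinct ?ys" "?ys \<noteq> []"
      using assms False mset_funpow_bubble[of j xs] mset_eq_imp_distinct_iff mset_zero_iff
      by metis+
    then have "inv_code {} ((bubble ^^ Suc j) xs) = map (\<lambda>c. c - 1) (tl (inv_code {} ?ys)) @ [0]"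
      by (simp add: inv_code_bubble)
    also have "\<dots> = map (\<lambda>c. c - Suc j) (drop (Suc j) (inv_code {} xs)) @
        replicate (min (Suc j) (length xs)) 0"
    proof (cases "j < length xs")
      case True
      then have "drop j (inv_code {} xs) \<noteq> []" by simp
      then have "tl (inv_code {} ?ys) =
          map (\<lambda>c. c - j) (drop (Suc j) (inv_code {} xs)) @ replicate j 0"
        using True by (simp add: Suc.IH drop_Suc tl_drop flip: map_tl)
      then show ?thesis using True by (simp add: replicate_append_same)
    next
      case False
      then show ?thesis using \<open>xs \<noteq> []\<close>
        by (cases "length xs") (auto simp: Suc.IH replicate_append_same)
    qed
    finally show ?case .
  qed
qed

section \<open>Codes of permutations as lists with bounded entries\<close>

lemma card_listset: "card (listset As) = prod_list (map card As)"
proof (induction As)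
  case (Cons A As)
  have "listset (A # As) = (\<lambda>(x, xs). x # xs) ` (A \<times> listset As)"
    by (auto simp: set_Cons_def)
  moreover have "inj_on (\<lambda>(x, xs). x # xs) (A \<times> listset As)"
    by (auto simp: inj_on_def)
  ultimately show ?case using Cons by (simp add: card_image card_cartesian_product)
qed simp

lemma listset_iff: "xs \<in> listset As \<longleftrightarrow> list_all2 (\<in>) xs As"
proof (induction As arbitrary: xs)
  case (Cons A As)
  then show ?case by (cases xs) (auto simp: set_Cons_def)
qed simp

text \<open>Only \<open>i\<close> elements precede position \<open>i\<close>, so the code entry
  there is at most \<open>i\<close>.\<close>

abbreviation code_bounds :: "nat \<Rightarrow> nat set list" where
  "code_bounds n \<equiv> map (\<lambda>i. {..i}) [0..<n]"

lemma prod_list_code_bounds: "prod_list (map card (code_bounds n)) = fact n"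
  by (induction n) auto

lemma length_Sym: "\<pi> \<in> Sym n \<Longrightarrow> length \<pi> = n"
  by (auto simp: Sym_def dest!: length_finite_permutations_of_set)

lemma distinct_Sym: "\<pi> \<in> Sym n \<Longrightarrow> distinct \<pi>"
  by (auto simp: Sym_def dest: permutations_of_setD)

lemma bubble_Sym_iff: "bubble \<tau> \<in> Sym n \<longleftrightarrow> \<tau> \<in> Sym n"
  by (simp add: Sym_def permutations_of_set_def distinct_bubble mset_eq_setD[OF mset_bubble])

text \<open>Surjectivity comes from counting rather than decoding: an injection between two sets of
  size \<open>fact n\<close>.\<close>

lemma bij_betw_inv_code: "bij_betw (inv_code {}) (Sym n) (listset (code_bounds n))"
proof -
  have inj: "inj_on (inv_code {}) (Sym n)"
    by (auto simp: Sym_def inj_on_def dest: permutations_of_setD intro!: inv_code_inj)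
  have sub: "inv_code {} ` Sym n \<subseteq> listset (code_bounds n)"
  proof (intro image_subsetI)
    fix \<pi> assume \<pi>: "\<pi> \<in> Sym n"
    have "inv_code {} \<pi> ! i \<le> i" if "i < n" for i
    proof -
      have "inv_code {} \<pi> ! i \<le> card (set (take i \<pi>))"
        using that length_Sym[OF \<pi>] by (auto simp: nth_inv_code intro!: card_mono)
      also have "\<dots> \<le> i" using card_length[of "take i \<pi>"] by simp
      finally show ?thesis .
    qed
    then show "inv_code {} \<pi> \<in> listset (code_bounds n)"
      using length_Sym[OF \<pi>] by (auto simp: listset_iff list_all2_conv_all_nth)
  qed
  have card: "card (listset (code_bounds n)) = fact n"
    by (simp only: card_listset prod_list_code_bounds)
  \<comment> \<open>Infinite sets have \<open>card\<close> zero, so a positive \<open>card\<close>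
    yields finiteness.\<close>
  then have "finite (listset (code_bounds n))"
    by (intro card_ge_0_finite) simp
  moreover have "card (inv_code {} ` Sym n) = fact n"
    using inj by (simp add: card_image Sym_def card_permutations_of_set)
  ultimately have "inv_code {} ` Sym n = listset (code_bounds n)"
    using sub card by (intro card_subset_eq) auto
  then show ?thesis using inj by (simp add: bij_betw_def)
qed

section \<open>Levels of the subtree as preimages under iterated passes\<close>

lemma Sym_inv_code_zero:
  assumes "\<pi> \<in> Sym n" "\<forall>i<n. inv_code {} \<pi> ! i = 0"
  shows "\<pi> = id_perm n"
proof -
  have "sorted \<pi>"
    using assms length_Sym[OF assms(1)]
    by (auto simp: sorted_iff_nth_mono nth_inv_code_eq_0_iff le_less)
  moreover have "set \<pi> = set [1..<Suc n]"
    using assms(1) unfolding Sym_def set_upt atLeastLessThanSuc_atLeastAtMost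
    by (rule permutations_of_setD(1))
  ultimately show ?thesis
    using distinct_Sym[OF assms(1)] unfolding id_perm_def
    by (metis sorted_distinct_set_unique sorted_upt distinct_upt)
qed

lemma funpow_bubble_eq_id:
  assumes "\<tau> \<in> Sym n" "(bubble ^^ j) \<tau> \<in> Sym n" "n \<le> j"
  shows "(bubble ^^ j) \<tau> = id_perm n"
  using assms length_Sym[of \<tau> n] distinct_Sym[of \<tau> n]
  by (intro Sym_inv_code_zero) (auto simp: inv_code_funpow_bubble nth_append)

text \<open>Going round the cycle \<open>n\<close> times makes \<open>p * n \<ge> n\<close> passes,
  which sort any permutation. This rules out loops and makes heights unique.\<close>

lemma funpow_bubble_fixed:
  assumes "\<pi> \<in> Sym n" "(bubble ^^ p) \<pi> = \<pi>" "p > 0"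
  shows "\<pi> = id_perm n"
proof -
  have "(bubble ^^ (p * n)) \<pi> = \<pi>"
    using assms(2) by (induction n) (auto simp: funpow_add)
  then show ?thesis
    using funpow_bubble_eq_id[of \<pi> n "p * n"] assms by auto
qed

text \<open>The point is to exclude the loop: a fixed point that some passes send to
  \<open>\<pi>\<close> would be \<open>\<pi>\<close> itself, hence the identity.\<close>

lemma relpow_bubble_tree_iff:
  assumes "\<pi> \<in> Sym n" "\<pi> \<noteq> id_perm n"
  shows "(\<pi>, \<tau>) \<in> bubble_tree n ^^ j \<longleftrightarrow> \<tau> \<in> Sym n \<and> (bubble ^^ j) \<tau> = \<pi>"
proof (induction j arbitrary: \<tau>)
  case 0
  then show ?case using assms by auto
next
  case (Suc j)
  have "bubble \<tau> \<noteq> \<tau>" if "(bubble ^^ Suc j) \<tau> = \<pi>"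
  proof
    assume fixed: "bubble \<tau> = \<tau>"
    then have "(bubble ^^ i) \<tau> = \<tau>" for i by (induction i) auto
    then have "\<pi> = \<tau>" using that by metis
    then show False using funpow_bubble_fixed[of \<pi> n 1] assms fixed by simp
  qed
  moreover have "(\<sigma>, \<tau>) \<in> bubble_tree n \<longleftrightarrow> \<tau> \<in> Sym n \<and> bubble \<tau> = \<sigma> \<and> \<sigma> \<noteq> \<tau>" for \<sigma>
    by (auto simp: bubble_tree_def bubble_Sym_iff)
  ultimately show ?case
    by (auto simp: relcomp_unfold Suc.IH bubble_Sym_iff funpow_Suc_right simp del: funpow.simps)
qed

lemma height_bubble_tree:
  assumes "\<pi> \<in> Sym n" "\<pi> \<noteq> id_perm n" "(\<pi>, \<tau>) \<in> bubble_tree n ^^ j"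
  shows "height (bubble_tree n) \<pi> \<tau> = j"
proof -
  \<comment> \<open>Reaching \<open>\<pi>\<close> after two different numbers of passes would make
    \<open>\<pi>\<close> periodic.\<close>
  have "\<not> i < i'" if "(bubble ^^ i) \<tau> = \<pi>" "(bubble ^^ i') \<tau> = \<pi>" for i i'
  proof
    assume "i < i'"
    then have "(bubble ^^ (i' - i)) ((bubble ^^ i) \<tau>) = \<pi>"
      using that(2) by (metis add.commute comp_apply funpow_add le_add_diff_inverse less_imp_le)
    then show False
      using funpow_bubble_fixed[of \<pi> n "i' - i"] assms that \<open>i < i'\<close> by simp
  qed
  then have "i = j" if "(\<pi>, \<tau>) \<in> bubble_tree n ^^ i" for i
    using that assms by (meson linorder_neqE_nat relpow_bubble_tree_iff)
  then show ?thesis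
    using assms(3) unfolding height_def by (rule the_equality[rotated])
qed

section \<open>Labels read off codes, and the sizes of the levels\<close>

lemma label_inv_code:
  assumes "distinct \<pi>" "label \<pi> = (k, m)"
  shows "k = length (filter (\<lambda>c. c = 0) (inv_code {} \<pi>))"
    and "j \<le> m \<longleftrightarrow> j \<le> length \<pi> \<and> drop (length \<pi> - j) (inv_code {} \<pi>) = replicate j 0"
proof -
  let ?n = "length \<pi>" and ?c = "inv_code {} \<pi>"
  \<comment> \<open>Distinctness turns the weak inequality of \<open>nth_inv_code_eq_0_iff\<close>
    into the strict one of \<open>ltr_maxima\<close>.\<close>
  have zero: "?c ! i = 0 \<longleftrightarrow> (\<forall>j<i. \<pi> ! j < \<pi> ! i)" if "i < ?n" for i
    using that assms(1) by (auto simp: nth_inv_code_eq_0_iff le_less nth_eq_iff_index_eq)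
  then have maxima: "ltr_maxima \<pi> = (!) \<pi> ` {i. i < ?n \<and> ?c ! i = 0}"
    by (auto simp: ltr_maxima_def)
  moreover have "inj_on ((!) \<pi>) {i. i < ?n \<and> ?c ! i = 0}"
    using assms(1) by (auto simp: inj_on_def nth_eq_iff_index_eq)
  ultimately have "card (ltr_maxima \<pi>) = card {i. i < ?n \<and> ?c ! i = 0}"
    by (simp add: card_image)
  then show "k = length (filter (\<lambda>c. c = 0) ?c)"
    using assms(2) by (simp add: label_def length_filter_conv_card)
  let ?S = "{length s | s. suffix s \<pi> \<and> set s \<subseteq> ltr_maxima \<pi>}"
  have in_maxima: "\<pi> ! i \<in> ltr_maxima \<pi> \<longleftrightarrow> ?c ! i = 0" if "i < ?n" for i
    using that assms(1) by (auto simp: maxima nth_eq_iff_index_eq)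
  have S_iff: "j \<in> ?S \<longleftrightarrow> j \<le> ?n \<and> set (drop (?n - j) \<pi>) \<subseteq> ltr_maxima \<pi>" for j
  proof
    assume "j \<in> ?S"
    then show "j \<le> ?n \<and> set (drop (?n - j) \<pi>) \<subseteq> ltr_maxima \<pi>"
      by (auto simp: suffix_def)
  next
    assume "j \<le> ?n \<and> set (drop (?n - j) \<pi>) \<subseteq> ltr_maxima \<pi>"
    then show "j \<in> ?S"
      by (auto intro!: exI[of _ "drop (?n - j) \<pi>"] simp: suffix_drop)
  qed
  have "finite ?S" by (rule finite_subset[of _ "{..?n}"]) (auto dest: suffix_length_le)
  moreover have "0 \<in> ?S" by (auto simp: S_iff)
  moreover have "i \<in> ?S" if "j \<in> ?S" "i \<le> j" for i j
    using that set_drop_subset_set_drop[of "?n - j" "?n - i" \<pi>] unfolding S_iff by force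
  moreover have "m = Max ?S" using assms(2) by (simp add: label_def)
  \<comment> \<open>The suffix lengths form a downward closed set, so comparing with their maximum
    is the same as membership.\<close>
  moreover have "j \<le> Max S \<longleftrightarrow> j \<in> S"
    if "finite S" "0 \<in> S" "\<And>i j. j \<in> S \<Longrightarrow> i \<le> j \<Longrightarrow> i \<in> S" for S :: "nat set"
    using Max_in[OF that(1)] Max_ge[OF that(1)] that(2,3) by blast
  ultimately have "j \<le> m \<longleftrightarrow> j \<in> ?S"
    by presburger
  also have "\<dots> \<longleftrightarrow> j \<le> ?n \<and> (\<forall>i<j. ?c ! (?n - j + i) = 0)"
  proof -
    have "j \<le> ?n \<Longrightarrow> set (drop (?n - j) \<pi>) = (\<lambda>i. \<pi> ! (?n - j + i)) ` {..<j}"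
      by (auto simp: set_conv_nth)
    then show ?thesis unfolding S_iff by (auto simp: in_maxima image_subset_iff)
  qed
  also have "\<dots> \<longleftrightarrow> j \<le> ?n \<and> drop (?n - j) ?c = replicate j 0"
    by (auto simp: list_eq_iff_nth_eq)
  finally show "j \<le> m \<longleftrightarrow> j \<le> ?n \<and> drop (?n - j) ?c = replicate j 0" .
qed

lemma card_level:
  assumes "\<pi> \<in> Sym n" "label \<pi> = (k, m)" "j \<le> m"
  shows "card {\<tau> \<in> Sym n. (bubble ^^ j) \<tau> = \<pi>} = fact j * (j + 1) ^ (k - j)"
proof -
  define d where "d = take (n - j) (inv_code {} \<pi>)"
  \<comment> \<open>The values that truncated subtraction of \<open>j\<close> sends to
    \<open>x\<close>: all of \<open>{..j}\<close> for zero, a single one otherwise.\<close>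
  let ?B = "\<lambda>x. if x = 0 then {..j} else {x + j}"
  note len = length_Sym[OF assms(1)] and dist = distinct_Sym[OF assms(1)]
  have "j \<le> n" and "drop (n - j) (inv_code {} \<pi>) = replicate j 0"
    using label_inv_code(2)[OF dist assms(2)] assms(3) len by auto
  then have code: "inv_code {} \<pi> = d @ replicate j 0"
    unfolding d_def by (metis append_take_drop_id)
  have len_d: "length d = n - j" using len by (simp add: d_def)
  have d_le: "d ! i \<le> i" if "i < n - j" for i
  proof -
    have "inv_code {} \<pi> \<in> listset (code_bounds n)"
      using bij_betw_inv_code assms(1) by (auto simp: bij_betw_def)
    then have "inv_code {} \<pi> ! i \<le> i"
      using that by (auto simp: listset_iff list_all2_conv_all_nth)
    then show ?thesis using that by (simp add: d_def)
  qed
  have split: "(\<forall>i<n. P i) \<longleftrightarrow> (\<forall>i<j. P i) \<and> (\<forall>i<n - j. P (j + i))" for P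
  proof -
    have "i < j \<or> (\<exists>i'<n - j. i = j + i')" if "i < n" for i
      using that by presburger
    then show ?thesis using \<open>j \<le> n\<close> by fastforce
  qed
  have eq_iff: "(bubble ^^ j) \<tau> = \<pi> \<longleftrightarrow> map (\<lambda>c. c - j) (drop j (inv_code {} \<tau>)) = d"
    if \<tau>: "\<tau> \<in> Sym n" for \<tau>
  proof -
    have "(bubble ^^ j) \<tau> \<in> Sym n"
      using \<tau> by (induction j) (auto simp: bubble_Sym_iff)
    then have "(bubble ^^ j) \<tau> = \<pi> \<longleftrightarrow> inv_code {} ((bubble ^^ j) \<tau>) = inv_code {} \<pi>"
      using bij_betw_inv_code[of n] assms(1) by (auto simp: bij_betw_def inj_on_def)
    then show ?thesis
      using \<tau> length_Sym[OF \<tau>] distinct_Sym[OF \<tau>] \<open>j \<le> n\<close>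
      by (simp add: inv_code_funpow_bubble code)
  qed
  have "bij_betw (inv_code {}) {\<tau> \<in> Sym n. (bubble ^^ j) \<tau> = \<pi>}
      {c \<in> listset (code_bounds n). map (\<lambda>c. c - j) (drop j c) = d}"
    by (rule bij_betw_Collect[OF bij_betw_inv_code]) (simp add: eq_iff)
  then have "card {\<tau> \<in> Sym n. (bubble ^^ j) \<tau> = \<pi>} =
      card {c \<in> listset (code_bounds n). map (\<lambda>c. c - j) (drop j c) = d}"
    by (rule bij_betw_same_card)
  also have "{c \<in> listset (code_bounds n). map (\<lambda>c. c - j) (drop j c) = d} =
      listset (code_bounds j @ map ?B d)"
  proof (intro set_eqI)
    fix c
    have "c \<in> listset (code_bounds j @ map ?B d) \<longleftrightarrow> length c = n \<and>
        (\<forall>i<j. c ! i \<le> i) \<and> (\<forall>i<n - j. c ! (j + i) \<in> ?B (d ! i))"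
      (is "_ \<longleftrightarrow> ?R")
      using \<open>j \<le> n\<close> len_d
      by (simp add: listset_iff list_all2_conv_all_nth split nth_append cong: conj_cong)
    moreover have "c \<in> listset (code_bounds n) \<and> map (\<lambda>c. c - j) (drop j c) = d \<longleftrightarrow> ?R"
    proof -
      \<comment> \<open>The code bound \<open>j + i\<close> agrees with \<open>?B\<close>: for
        \<open>y = 0\<close> the values stop at \<open>j\<close> anyway, and for
        \<open>y > 0\<close> the value \<open>y + j\<close> is admissible by
        \<open>y \<le> i\<close>.\<close>
      have B: "x \<in> ?B y \<longleftrightarrow> x \<le> j + i \<and> x - j = y" if "y \<le> i" for x y i
        using that by auto
      have "c \<in> listset (code_bounds n) \<longleftrightarrow> length c = n \<and>
          (\<forall>i<j. c ! i \<le> i) \<and> (\<forall>i<n - j. c ! (j + i) \<le> j + i)"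
        by (simp add: listset_iff list_all2_conv_all_nth split cong: conj_cong)
      moreover have "length c = n \<Longrightarrow> map (\<lambda>c. c - j) (drop j c) = d \<longleftrightarrow>
          (\<forall>i<n - j. c ! (j + i) - j = d ! i)"
        using len_d by (auto simp: list_eq_iff_nth_eq)
      moreover have "(\<forall>i<n - j. c ! (j + i) \<in> ?B (d ! i)) \<longleftrightarrow>
          (\<forall>i<n - j. c ! (j + i) \<le> j + i \<and> c ! (j + i) - j = d ! i)"
        using B[OF d_le] by blast
      ultimately show ?thesis by blast
    qed
    ultimately show "c \<in> {c \<in> listset (code_bounds n). map (\<lambda>c. c - j) (drop j c) = d} \<longleftrightarrow>
        c \<in> listset (code_bounds j @ map ?B d)"
      by simp
  qed
  also have "card \<dots> = fact j * prod_list (map (card \<circ> ?B) d)"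
    using prod_list_code_bounds[of j] by (simp add: card_listset)
  also have "prod_list (map (card \<circ> ?B) d) = (j + 1) ^ length (filter (\<lambda>c. c = 0) d)"
    by (induction d) auto
  \<comment> \<open>The code of \<open>\<pi>\<close> has \<open>k\<close> zeros, and
    \<open>d\<close> omits \<open>j\<close> trailing ones.\<close>
  also have "length (filter (\<lambda>c. c = 0) d) = k - j"
    using label_inv_code(1)[OF dist assms(2)] by (simp add: code)
  finally show ?thesis .
qed

text \<open>With \<open>n\<close> or more passes the result would be the identity, so
  \<open>j < n\<close>, and then the \<open>j\<close> zeros appended by the passes end the code of
  \<open>\<pi>\<close>.\<close>

lemma level_le:
  assumes "\<pi> \<in> Sym n" "\<pi> \<noteq> id_perm n" "label \<pi> = (k, m)" "\<tau> \<in> Sym n" "(bubble ^^ j) \<tau> = \<pi>"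
  shows "j \<le> m"
proof -
  have "j \<le> n" using funpow_bubble_eq_id[of \<tau> n j] assms by (cases "n \<le> j") auto
  moreover have "drop (n - j) (inv_code {} \<pi>) = replicate j 0"
    using inv_code_funpow_bubble[of \<tau> j] distinct_Sym[of \<tau> n] length_Sym[of \<tau> n] assms \<open>j \<le> n\<close>
    by auto
  ultimately show ?thesis
    using label_inv_code(2)[of \<pi>] distinct_Sym[of \<pi> n] length_Sym[of \<pi> n] assms by auto
qed

theorem proposition4p6:
  fixes n k m :: nat and \<pi> :: "nat list"
  assumes "\<pi> \<in> Sym n"
    and "\<pi> \<noteq> id_perm n"
    and "label \<pi> = (k, m)"
  shows "card (subtree_nodes (bubble_tree n) \<pi>) = (\<Sum>j=0..m. fact j * (j + 1) ^ (k - j))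
    \<and> (\<forall>j\<le>m. card {\<tau> \<in> subtree_nodes (bubble_tree n) \<pi>. height (bubble_tree n) \<pi> \<tau> = j}
           = fact j * (j + 1) ^ (k - j))"
proof -
  let ?N = "subtree_nodes (bubble_tree n) \<pi>" and ?h = "height (bubble_tree n) \<pi>"
  let ?L = "\<lambda>j. {\<tau> \<in> Sym n. (bubble ^^ j) \<tau> = \<pi>}"
  \<comment> \<open>Every descendant is reached by some power of the edge relation, and the exponent
    is its height.\<close>
  have level: "{\<tau> \<in> ?N. ?h \<tau> = j} = ?L j" for j
    using height_bubble_tree[OF assms(1,2)] relpow_bubble_tree_iff[OF assms(1,2)]
    by (auto simp: subtree_nodes_def rtrancl_is_UN_relpow)
  have height_le: "?h \<tau> \<le> m" if "\<tau> \<in> ?N" for \<tau>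
    using that level[of "?h \<tau>"] level_le[OF assms] by auto
  have "finite (?L j)" for j by (simp add: Sym_def)
  then have "finite {\<tau> \<in> ?N. ?h \<tau> = j}" for j by (simp only: level)
  then have "card (\<Union>j\<in>{0..m}. {\<tau> \<in> ?N. ?h \<tau> = j}) = (\<Sum>j=0..m. card {\<tau> \<in> ?N. ?h \<tau> = j})"
    by (intro card_UN_disjoint) auto
  moreover have "(\<Union>j\<in>{0..m}. {\<tau> \<in> ?N. ?h \<tau> = j}) = ?N"
    using height_le by auto
  ultimately have "card ?N = (\<Sum>j=0..m. card (?L j))"
    by (simp only: level)
  then show ?thesis
    using card_level[OF assms(1,3)] by (simp add: level)
qed

end
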